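(* Let $0\le\alpha<\frac14$. Then there exists a set $A\subset\mathbb{N}$ having Buck density $\mu(A)=\alpha$ and such that $\underline{\mu}(A+A)\neq\overline{\mu}(A+A)$.
   Context: $\mathbb{N}=\{0,1,2,\dots\}$; $A+A=\{a+b:a,b\in A\}$. Let $\mathcal{Z}$ be the family of all finite unions $\bigcup_{i=1}^r(a_i+k_i\mathbb{N})$ with $r,a_i,k_i\in\mathbb{N}$; each $B\in\mathcal{Z}$ has a natural density $d(B)=\lim_{n\to\infty}|B\cap[1,n]|/n$. For $X\subset\mathbb{N}$, the upper Buck density is $\overline{\mu}(X)=\inf\{d(B): X\subset B\in\mathcal{Z}\}$ and the lower Buck density is $\underline{\mu}(X)=\sup\{d(B): X\supset B\in\mathcal{Z}\}$ $(=1-\overline{\mu}(\mathbb{N}\setminus X))$. If they coincide, $X$ has Buck density $\mu(X)$ equal to the common value. *)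

theory Defs
  imports Complex_Main "HOL-Library.Set_Algebras"
begin

(* A modulus 0 is allowed and gives a singleton; r = 0 gives the empty set. *)
definition ap_unions :: "nat set set" where
  "ap_unions = {B. \<exists>(r::nat) (a::nat \<Rightarrow> nat) (k::nat \<Rightarrow> nat).
     B = (\<Union>i\<in>{1..r}. {a i + k i * n | n. True})}"

(* Only meaningful when the limit exists, as it does for every member of ap_unions. *)
definition natural_density :: "nat set \<Rightarrow> real" where
  "natural_density B = lim (\<lambda>n. real (card (B \<inter> {1..n})) / real n)"

(* The families below are nonempty (they contain UNIV and the empty set, respectively)
   and their densities lie in [0,1], so the real-valued Inf and Sup are the intended ones. *)
definition upper_buck_density :: "nat set \<Rightarrow> real" where
  "upper_buck_density X = (INF B\<in>{B \<in> ap_unions. X \<subseteq> B}. natural_density B)"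

definition lower_buck_density :: "nat set \<Rightarrow> real" where
  "lower_buck_density X = (SUP B\<in>{B \<in> ap_unions. B \<subseteq> X}. natural_density B)"

definition has_buck_density :: "nat set \<Rightarrow> real \<Rightarrow> bool" where
  "has_buck_density X d \<longleftrightarrow> lower_buck_density X = d \<and> upper_buck_density X = d"

end

(* A is the union of a set D of multiples of 4 with Buck density alpha and a set S of numbers
   congruent to 1 modulo 4 with Buck density 0. Then S + S is the part of A + A congruent to 2
   modulo 4. If S + S meets every residue class inside 2 + 4N but contains no infinite arithmetic
   progression, then any two members of the family enclosing A + A differ in density by at
   least 1/4.

   D is cut out of 4N by the binary digits of 4 alpha: the i-th digit decides on the class of
   2^i - 1 modulo 2^(i+1), scaled by 4. For S, every n is a sum of a number with binary digits only
   in even positions and one with digits only in odd positions, and each of the two kinds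
   occupies only 2^k classes modulo 4^k. Adding n! to the n-th term of a sequence t of such
   numbers preserves its residues (up to finitely many terms) but makes the sequence lacunary,
   so that its sums leave arbitrarily long gaps. *)

theory Submission
  imports Defs "HOL-Library.Disjoint_Sets"
begin

section \<open>Natural density as a limit relation, and the density of arithmetic
  progressions\<close>

text \<open>The relation includes convergence, which an equation about the \<open>lim\<close> in
  \<open>natural_density\<close> does not; limit laws therefore apply to it directly.\<close>

definition has_density :: "nat set \<Rightarrow> real \<Rightarrow> bool" where
  "has_density B d \<longleftrightarrow> (\<lambda>n. real (card (B \<inter> {1..n})) / real n) \<longlonglongrightarrow> d"

definition arith_prog :: "nat \<Rightarrow> nat \<Rightarrow> nat set" where
  "arith_prog a k = {a + k * n | n. True}"

lemma natural_density_eqI: "has_density B d \<Longrightarrow> natural_density B = d"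
  unfolding has_density_def natural_density_def by (rule limI)

lemma has_density_Un:
  assumes "has_density X c" "has_density Y d" "X \<inter> Y = {}"
  shows "has_density (X \<union> Y) (c + d)"
proof -
  have "real (card ((X \<union> Y) \<inter> {1..n})) / real n
      = real (card (X \<inter> {1..n})) / real n + real (card (Y \<inter> {1..n})) / real n" for n
  proof -
    have "card ((X \<union> Y) \<inter> {1..n}) = card (X \<inter> {1..n}) + card (Y \<inter> {1..n})"
      unfolding Int_Un_distrib2 using assms(3) by (intro card_Un_disjoint) auto
    then show ?thesis by (simp add: add_divide_distrib)
  qed
  then show ?thesis
    using tendsto_add[OF assms(1,2)[unfolded has_density_def]] by (simp add: has_density_def)
qed

text \<open>Finitely many exceptions change the counts by a bounded amount, which vanishes after
  division by \<open>n\<close>. The exceptions are allowed because eventual periodicity controls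
  sets only from some point on.\<close>

lemma has_density_almost_mono:
  assumes "has_density X c" "has_density Y d" "finite (X - Y)"
  shows "c \<le> d"
proof -
  let ?C = "real (card (X - Y))"
  have "(\<lambda>n. real (card (Y \<inter> {1..n})) / real n + ?C / real n) \<longlonglongrightarrow> d + 0"
    using assms(2) unfolding has_density_def by (intro tendsto_add lim_const_over_n)
  moreover have "real (card (X \<inter> {1..n})) / real n \<le> real (card (Y \<inter> {1..n})) / real n + ?C / real n" for n
  proof -
    have "card (X \<inter> {1..n}) \<le> card ((Y \<inter> {1..n}) \<union> (X - Y))"
      using assms(3) by (intro card_mono) auto
    also have "\<dots> \<le> card (Y \<inter> {1..n}) + card (X - Y)" by (rule card_Un_le)
    finally show ?thesis
      by (simp add: divide_right_mono flip: add_divide_distrib of_nat_add)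
  qed
  ultimately show ?thesis
    using LIMSEQ_le[OF assms(1)[unfolded has_density_def]] by fastforce
qed

lemma has_density_finite:
  assumes "finite X"
  shows "has_density X 0"
  unfolding has_density_def
proof (rule tendsto_sandwich[of "\<lambda>_. 0"])
  show "\<forall>\<^sub>F n in sequentially. real (card (X \<inter> {1..n})) / real n \<le> real (card X) / real n"
    using assms by (intro always_eventually allI divide_right_mono) (auto intro: card_mono)
qed (auto intro: lim_const_over_n always_eventually)

lemma has_density_UN:
  assumes "finite I" "\<And>i. i \<in> I \<Longrightarrow> has_density (X i) (d i)" "disjoint_family_on X I"
  shows "has_density (\<Union>i\<in>I. X i) (\<Sum>i\<in>I. d i)"
  using assms
proof (induction I rule: finite_induct)
  case empty
  then show ?case using has_density_finite by simp
next
  case (insert i I)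
  have "X i \<inter> (\<Union>j\<in>I. X j) = {}"
    using insert by (force simp: disjoint_family_on_def)
  moreover have "disjoint_family_on X I"
    using insert by (auto simp: disjoint_family_on_def)
  ultimately show ?case
    using insert has_density_Un[of "X i" "d i"] by simp
qed

text \<open>For \<open>n \<ge> a\<close> exactly \<open>(n - a) div k + 1\<close> members are at
  most \<open>n\<close>, so the count differs from \<open>n / k\<close> by a bounded amount, which
  division by \<open>n\<close> removes.\<close>

lemma has_density_arith_prog:
  assumes "k > 0"
  shows "has_density (arith_prog a k) (1 / real k)"
proof -
  define c where "c n = card (arith_prog a k \<inter> {1..n})" for n
  define C where "C = real a / real k + 1"
  have bounds: "real n / real k - C \<le> real (c n) \<and> real (c n) \<le> real n / real k + 1" if "n \<ge> a" for n
  proof -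
    define q where "q = (n - a) div k"
    have eq: "arith_prog a k \<inter> {..n} = (\<lambda>j. a + k * j) ` {..q}"
    proof -
      have "a + k * j \<le> n \<longleftrightarrow> j \<le> q" for j
        using that assms by (auto simp: q_def less_eq_div_iff_mult_less_eq algebra_simps)
      then show ?thesis by (auto simp: arith_prog_def)
    qed
    have card: "card (arith_prog a k \<inter> {..n}) = q + 1"
      unfolding eq using assms by (subst card_image) (auto simp: inj_on_def)
    have "c n \<le> q + 1"
      unfolding c_def card[symmetric] by (intro card_mono) auto
    moreover have "q + 1 \<le> c n + 1"
    proof -
      \<comment> \<open>The number 0 may belong to the progression but lies outside
        \<open>{1..n}\<close>, so at most one member is lost.\<close>
      have "card (arith_prog a k \<inter> {..n}) \<le> card (insert 0 (arith_prog a k \<inter> {1..n}))"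
        by (intro card_mono) (auto simp: Suc_le_eq)
      also have "\<dots> \<le> c n + 1" unfolding c_def by (simp add: card_insert_if)
      finally show ?thesis using card by simp
    qed
    moreover have "\<lfloor>real (n - a) / real k\<rfloor> = int q"
      unfolding q_def by (rule floor_divide_of_nat_eq)
    moreover have "real (n - a) / real k = real n / real k - real a / real k"
      using that by (simp add: diff_divide_distrib)
    moreover have "real a / real k \<ge> 0" by simp
    ultimately show ?thesis unfolding C_def by linarith
  qed
  have lim: "(\<lambda>n. (real n / real k + x) / real n) \<longlonglongrightarrow> 1 / real k" for x :: real
  proof -
    have "(\<lambda>n. 1 / real k + x / real n) \<longlonglongrightarrow> 1 / real k + 0"
      by (intro tendsto_add tendsto_const lim_const_over_n)
    moreover have "\<forall>\<^sub>F n in sequentially. 1 / real k + x / real n = (real n / real k + x) / real n"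
      using eventually_gt_at_top[of 0] by eventually_elim (simp add: add_divide_distrib)
    ultimately show ?thesis by (simp add: filterlim_cong)
  qed
  show ?thesis
    unfolding has_density_def
  proof (rule tendsto_sandwich[OF _ _ lim[of "- C"] lim[of 1]])
    show "\<forall>\<^sub>F n in sequentially. (real n / real k + - C) / real n \<le> real (card (arith_prog a k \<inter> {1..n})) / real n"
      using eventually_ge_at_top[of a] by eventually_elim
        (use bounds in \<open>auto simp: c_def intro!: divide_right_mono\<close>)
    show "\<forall>\<^sub>F n in sequentially. real (card (arith_prog a k \<inter> {1..n})) / real n \<le> (real n / real k + 1) / real n"
      using eventually_ge_at_top[of a] by eventually_elim
        (use bounds in \<open>auto simp: c_def intro!: divide_right_mono\<close>)
  qed
qed

section \<open>Finite unions of arithmetic progressions: closure, eventual periodicity, existence of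
  the density\<close>

text \<open>Indexing by a finite set of pairs instead of \<open>{1..r}\<close> makes closure under
  union a matter of taking \<open>F \<union> G\<close>.\<close>

lemma ap_unions_iff:
  "B \<in> ap_unions \<longleftrightarrow> (\<exists>F. finite F \<and> B = (\<Union>(a, k)\<in>F. arith_prog a k))"
proof
  assume "B \<in> ap_unions"
  then obtain r a k where "B = (\<Union>i\<in>{1..r::nat}. arith_prog (a i) (k i))"
    unfolding ap_unions_def arith_prog_def by blast
  then show "\<exists>F. finite F \<and> B = (\<Union>(a, k)\<in>F. arith_prog a k)"
    by (intro exI[of _ "(\<lambda>i. (a i, k i)) ` {1..r}"]) auto
next
  assume "\<exists>F. finite F \<and> B = (\<Union>(a, k)\<in>F. arith_prog a k)"
  then obtain F where F: "finite F" "B = (\<Union>(a, k)\<in>F. arith_prog a k)" by blast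
  obtain h where "bij_betw h {1..card F} F"
    using ex_bij_betw_nat_finite_1[OF F(1)] by blast
  then have "F = h ` {1..card F}" by (simp add: bij_betw_def)
  then have "B = (\<Union>i\<in>{1..card F}. arith_prog (fst (h i)) (snd (h i)))"
    using F(2) by (metis (no_types, lifting) SUP_cong UN_extend_simps(10) case_prod_beta)
  then show "B \<in> ap_unions"
    unfolding ap_unions_def arith_prog_def
    by (intro CollectI exI[of _ "card F"] exI[of _ "\<lambda>i. fst (h i)"] exI[of _ "\<lambda>i. snd (h i)"])
qed

lemma UN_arith_prog_in_ap_unions:
  assumes "finite I"
  shows "(\<Union>i\<in>I. arith_prog (a i) (k i)) \<in> ap_unions"
  unfolding ap_unions_iff using assms by (intro exI[of _ "(\<lambda>i. (a i, k i)) ` I"]) auto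

lemma arith_prog_in_ap_unions: "arith_prog a k \<in> ap_unions"
  using UN_arith_prog_in_ap_unions[of "{0}" "\<lambda>_. a" "\<lambda>_. k"] by simp

lemma ap_unions_Un:
  assumes "X \<in> ap_unions" "Y \<in> ap_unions"
  shows "X \<union> Y \<in> ap_unions"
proof -
  obtain F G where "finite F" "X = (\<Union>(a, k)\<in>F. arith_prog a k)"
      "finite G" "Y = (\<Union>(a, k)\<in>G. arith_prog a k)"
    using assms unfolding ap_unions_iff by blast
  then show ?thesis unfolding ap_unions_iff by (intro exI[of _ "F \<union> G"]) auto
qed

lemma finite_in_ap_unions: "finite X \<Longrightarrow> X \<in> ap_unions"
  using UN_arith_prog_in_ap_unions[of X "\<lambda>x. x" "\<lambda>_. 0"] by (simp add: arith_prog_def)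

lemma UNIV_in_ap_unions: "UNIV \<in> ap_unions"
  using UN_arith_prog_in_ap_unions[of "{0}" "\<lambda>_. 0" "\<lambda>_. 1"] by (simp add: arith_prog_def)

lemma arith_prog_eventually_periodic:
  assumes "n > a" "k dvd K"
  shows "n + K * j \<in> arith_prog a k \<longleftrightarrow> n \<in> arith_prog a k"
proof -
  have mem: "x \<in> arith_prog a k \<longleftrightarrow> k dvd (x - a)" if "x \<ge> a" for x
    using that by (auto simp: arith_prog_def dvd_def) (metis le_add_diff_inverse)
  have eq: "n + K * j - a = (n - a) + K * j" using assms by simp
  have "k dvd K * j" using assms by simp
  then have "k dvd (n - a) + K * j \<longleftrightarrow> k dvd (n - a)" by (rule dvd_add_left_iff)
  then show ?thesis using assms by (simp only: mem eq trans_le_add1 less_imp_le)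
qed

lemma ap_unions_eventually_periodic:
  assumes "B \<in> ap_unions"
  obtains K N where "K > 0" "\<And>n j. n \<ge> N \<Longrightarrow> n + K * j \<in> B \<longleftrightarrow> n \<in> B"
proof -
  obtain F where F: "finite F" "B = (\<Union>(a, k)\<in>F. arith_prog a k)"
    using assms unfolding ap_unions_iff by blast
  \<comment> \<open>A common period and a common threshold. Taking \<open>max 1 k\<close> keeps the
    product positive when a modulus is 0; the progressions with modulus 0 are single points, and all
    of them lie strictly below \<open>N\<close>.\<close>
  define K where "K = (\<Prod>(a, k)\<in>F. max 1 k)"
  define N where "N = Suc (\<Sum>(a, k)\<in>F. a)"
  have "n + K * j \<in> arith_prog a k \<longleftrightarrow> n \<in> arith_prog a k" if "n \<ge> N" "(a, k) \<in> F" for n j a k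
  proof -
    have "a \<le> (\<Sum>(a, k)\<in>F. a)"
      using member_le_sum[OF that(2), of "\<lambda>(a, k). a"] F(1) by simp
    then have "n > a" using that by (simp add: N_def)
    show ?thesis
    proof (cases "k = 0")
      case True
      then show ?thesis using \<open>n > a\<close> by (auto simp: arith_prog_def)
    next
      case False
      have "(case (a, k) of (a, k) \<Rightarrow> max 1 k) dvd K"
        unfolding K_def using F(1) that(2) by (rule dvd_prodI)
      then have "k dvd K" using False by (simp add: max_def split: if_splits)
      then show ?thesis using arith_prog_eventually_periodic[OF \<open>n > a\<close>] by simp
    qed
  qed
  then have "\<And>n j. n \<ge> N \<Longrightarrow> n + K * j \<in> B \<longleftrightarrow> n \<in> B"
    unfolding F(2) by blast
  moreover have "K > 0" unfolding K_def by (intro prod_pos) auto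
  ultimately show ?thesis using that by blast
qed

text \<open>By eventual periodicity the part from \<open>N\<close> on is a disjoint union of
  progressions modulo \<open>K\<close>, one for each member of the window
  \<open>{N..<N + K}\<close>; the rest is finite.\<close>

lemma ap_unions_has_density:
  assumes "B \<in> ap_unions"
  shows "has_density B (natural_density B)"
proof -
  obtain K N where K: "K > 0" and per: "\<And>n j. n \<ge> N \<Longrightarrow> n + K * j \<in> B \<longleftrightarrow> n \<in> B"
    using ap_unions_eventually_periodic[OF assms] by metis
  define R where "R = B \<inter> {N..<N + K}"
  have eq: "B \<inter> {N..} = (\<Union>r\<in>R. arith_prog r K)"
  proof (intro equalityI subsetI)
    fix n assume n: "n \<in> B \<inter> {N..}"
    define r where "r = N + (n - N) mod K"
    have "n = r + K * ((n - N) div K)" using n by (simp add: r_def)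
    moreover have "r \<ge> N" "r < N + K" using K by (auto simp: r_def)
    ultimately have "r \<in> R" "n \<in> arith_prog r K"
      using n per[of r "(n - N) div K"] by (auto simp: R_def arith_prog_def)
    then show "n \<in> (\<Union>r\<in>R. arith_prog r K)" by blast
  qed (auto simp: R_def arith_prog_def per)
  have "disjoint_family_on (\<lambda>r. arith_prog r K) R"
  proof -
    have "r = r'" if "r \<in> R" "r' \<in> R" "r + K * i = r' + K * j" for r r' i j
    proof -
      have "(r - N) + K * i = (r' - N) + K * j" using that by (auto simp: R_def)
      then have "((r - N) + K * i) mod K = ((r' - N) + K * j) mod K" by simp
      moreover have "r - N < K" "r' - N < K" using that by (auto simp: R_def)
      ultimately have "r - N = r' - N" by simp
      then show ?thesis using that by (auto simp: R_def)
    qed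
    then show ?thesis by (auto simp: disjoint_family_on_def arith_prog_def)
  qed
  then have "has_density (B \<inter> {N..}) (\<Sum>r\<in>R. 1 / real K)"
    unfolding eq using K by (intro has_density_UN has_density_arith_prog) (auto simp: R_def)
  then have "has_density (B \<inter> {N..} \<union> B \<inter> {..<N}) ((\<Sum>r\<in>R. 1 / real K) + 0)"
    by (rule has_density_Un) (auto intro: has_density_finite)
  moreover have "B \<inter> {N..} \<union> B \<inter> {..<N} = B" by auto
  ultimately show ?thesis using natural_density_eqI by metis
qed

section \<open>Monotonicity and subadditivity of the density on the family\<close>

lemma natural_density_mono:
  assumes "X \<in> ap_unions" "Y \<in> ap_unions" "X \<subseteq> Y"
  shows "natural_density X \<le> natural_density Y"
proof -
  have "finite (X - Y)" using assms(3) by (simp add: Diff_eq_empty_iff[THEN iffD2])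
  then show ?thesis
    using has_density_almost_mono ap_unions_has_density assms(1,2) by blast
qed

lemma natural_density_Un_le:
  assumes "X \<in> ap_unions" "Y \<in> ap_unions"
  shows "natural_density (X \<union> Y) \<le> natural_density X + natural_density Y"
proof -
  have le: "card ((X \<union> Y) \<inter> {1..n}) \<le> card (X \<inter> {1..n}) + card (Y \<inter> {1..n})" for n
    unfolding Int_Un_distrib2 by (rule card_Un_le)
  have "real (card ((X \<union> Y) \<inter> {1..n})) / real n
      \<le> real (card (X \<inter> {1..n})) / real n + real (card (Y \<inter> {1..n})) / real n" for n
    using le[of n] by (simp add: divide_right_mono flip: add_divide_distrib of_nat_add)
  moreover note tendsto_add[OF ap_unions_has_density[OF assms(1), unfolded has_density_def]
      ap_unions_has_density[OF assms(2), unfolded has_density_def]]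
  moreover note ap_unions_has_density[OF ap_unions_Un[OF assms], unfolded has_density_def]
  ultimately show ?thesis by (intro LIMSEQ_le) auto
qed

lemma natural_density_finite: "finite X \<Longrightarrow> natural_density X = 0"
  using has_density_finite natural_density_eqI by blast

lemma natural_density_UN_arith_prog_le:
  assumes "finite I" "\<And>i. i \<in> I \<Longrightarrow> k i > 0"
  shows "natural_density (\<Union>i\<in>I. arith_prog (a i) (k i)) \<le> (\<Sum>i\<in>I. 1 / real (k i))"
  using assms
proof (induction I rule: finite_induct)
  case empty
  then show ?case using natural_density_finite[of "{}"] by simp
next
  case (insert i I)
  have "arith_prog (a i) (k i) \<in> ap_unions"
    by (rule arith_prog_in_ap_unions)
  moreover have "natural_density (arith_prog (a i) (k i)) = 1 / real (k i)"
    using insert has_density_arith_prog natural_density_eqI by blast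
  ultimately show ?case
    using insert natural_density_Un_le[of "arith_prog (a i) (k i)" "\<Union>i\<in>I. arith_prog (a i) (k i)"]
      UN_arith_prog_in_ap_unions[OF insert.hyps(1), of a k] by simp
qed

lemma natural_density_nonneg:
  assumes "X \<in> ap_unions"
  shows "0 \<le> natural_density X"
  using natural_density_mono[OF finite_in_ap_unions[of "{}"] assms] natural_density_finite[of "{}"] by simp

section \<open>Bounds for the upper and lower Buck densities\<close>

lemma upper_buck_density_le:
  assumes "B \<in> ap_unions" "X \<subseteq> B"
  shows "upper_buck_density X \<le> natural_density B"
  unfolding upper_buck_density_def using assms
  by (intro cINF_lower) (auto intro!: bdd_belowI[of _ 0] natural_density_nonneg)

lemma lower_buck_density_ge:
  assumes "B \<in> ap_unions" "B \<subseteq> X"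
  shows "natural_density B \<le> lower_buck_density X"
  unfolding lower_buck_density_def using assms UNIV_in_ap_unions
  by (intro cSUP_upper) (auto intro!: bdd_aboveI[of _ "natural_density UNIV"] natural_density_mono)

text \<open>A gap that is uniform over all inner and outer approximations survives the supremum and
  the infimum. The case \<open>\<delta> = 0\<close> orders the two densities; the case 1/4 separates
  them for the sumset.\<close>

lemma buck_density_gapI:
  assumes "\<And>B C. B \<in> ap_unions \<Longrightarrow> C \<in> ap_unions \<Longrightarrow> B \<subseteq> X \<Longrightarrow> X \<subseteq> C
    \<Longrightarrow> natural_density B + \<delta> \<le> natural_density C"
  shows "lower_buck_density X + \<delta> \<le> upper_buck_density X"
proof -
  have "{} \<in> {B \<in> ap_unions. B \<subseteq> X}" "UNIV \<in> {B \<in> ap_unions. X \<subseteq> B}"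
    using finite_in_ap_unions UNIV_in_ap_unions by auto
  then have ne: "{B \<in> ap_unions. B \<subseteq> X} \<noteq> {}" "{B \<in> ap_unions. X \<subseteq> B} \<noteq> {}" by blast+
  show ?thesis
    unfolding upper_buck_density_def
  proof (rule cINF_greatest[OF ne(2)])
    fix C assume C: "C \<in> {B \<in> ap_unions. X \<subseteq> B}"
    have "lower_buck_density X \<le> natural_density C - \<delta>"
      unfolding lower_buck_density_def
      by (rule cSUP_least[OF ne(1)]) (use C assms in \<open>force simp: algebra_simps\<close>)
    then show "lower_buck_density X + \<delta> \<le> natural_density C" by simp
  qed
qed

lemma lower_le_upper_buck_density: "lower_buck_density X \<le> upper_buck_density X"
  using buck_density_gapI[of X 0] natural_density_mono by simp

section \<open>Binary digits in even and odd positions\<close>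

text \<open>Moves the binary digit at position \<open>i\<close> to position \<open>2 i\<close>.\<close>

fun spread :: "nat \<Rightarrow> nat" where
  "spread n = (if n = 0 then 0 else n mod 2 + 4 * spread (n div 2))"

declare spread.simps [simp del]

lemma spread_0: "spread 0 = 0"
  by (subst spread.simps) simp

lemma spread_rec: "spread n = n mod 2 + 4 * spread (n div 2)"
  by (cases "n = 0", simp add: spread_0, subst spread.simps, simp)

text \<open>Induction along base 4: the last two binary digits of \<open>n\<close> become the last
  digits of \<open>a\<close> and \<open>b\<close>, and \<open>n div 4\<close> supplies the
  others.\<close>

lemma spread_decomposition: "\<exists>a b. n = spread a + 2 * spread b"
proof (induction n rule: less_induct)
  case (less n)
  show ?case
  proof (cases "n = 0")
    case True
    then have "n = spread 0 + 2 * spread 0" by (simp add: spread_0)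
    then show ?thesis by blast
  next
    case False
    then obtain a b where ab: "n div 4 = spread a + 2 * spread b"
      using less[of "n div 4"] by auto
    have "spread (2 * a + n mod 2) = n mod 2 + 4 * spread a"
      by (subst spread_rec) simp
    moreover have "spread (2 * b + n div 2 mod 2) = n div 2 mod 2 + 4 * spread b"
      by (subst spread_rec) simp
    moreover have "n = 2 * (n div 2) + n mod 2" "n div 2 = 2 * (n div 2 div 2) + n div 2 mod 2"
      by simp_all
    moreover have "n div 2 div 2 = n div 4" by (simp flip: div_mult2_eq)
    ultimately have "n = spread (2 * a + n mod 2) + 2 * spread (2 * b + n div 2 mod 2)"
      using ab by linarith
    then show ?thesis by blast
  qed
qed

text \<open>Modulo \<open>4 ^ k\<close> only the lowest \<open>k\<close> binary digits of
  \<open>n\<close> matter, and they form \<open>r\<close>. Hence the range of \<open>spread\<close>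
  occupies at most \<open>2 ^ k\<close> of the \<open>4 ^ k\<close> residue classes.\<close>

lemma spread_in_arith_progs: "\<exists>r<2 ^ k. \<exists>q. spread n = spread r + 4 ^ k * q"
proof (induction k arbitrary: n)
  case 0
  then show ?case by (simp add: spread_0)
next
  case (Suc k)
  obtain r q where rq: "r < 2 ^ k" "spread (n div 2) = spread r + 4 ^ k * q"
    using Suc.IH by blast
  have "spread (2 * r + n mod 2) = n mod 2 + 4 * spread r"
    by (subst spread_rec) simp
  then have "spread n = spread (2 * r + n mod 2) + 4 ^ Suc k * q"
    using spread_rec[of n] rq(2) by simp
  moreover have "2 * r + n mod 2 < 2 ^ Suc k"
    using rq(1) mod_less_divisor[of 2 n] unfolding power_Suc by linarith
  ultimately show ?case by blast
qed

text \<open>The two summands of \<open>n\<close> are put at the neighbouring indices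
  \<open>2 * n\<close> and \<open>Suc (2 * n)\<close>, so that one sequence carries both kinds. The
  bound \<open>t n \<le> n\<close> lets factorials dominate it later.\<close>

lemma exists_interleaved_summands:
  "\<exists>t. (\<forall>n. t n \<le> n) \<and> (\<forall>n. t n \<in> range spread \<union> range (\<lambda>a. 2 * spread a))
    \<and> (\<forall>n. t (2 * n) + t (Suc (2 * n)) = n)"
proof -
  obtain a b where ab: "\<And>n. n = spread (a n) + 2 * spread (b n)"
    using spread_decomposition by metis
  define t where "t n = (if even n then spread (a (n div 2)) else 2 * spread (b (n div 2)))" for n
  have "t n \<le> n" for n
    using ab[of "n div 2"] by (auto simp: t_def)
  moreover have "t n \<in> range spread \<union> range (\<lambda>a. 2 * spread a)" for n
    by (auto simp: t_def)
  moreover have "t (2 * n) + t (Suc (2 * n)) = n" for n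
    using ab[of n] by (simp add: t_def)
  ultimately show ?thesis by blast
qed

section \<open>Lacunary sequences and the thin set S\<close>

text \<open>No sum lies strictly between \<open>2 * s n\<close> and \<open>s (Suc n)\<close>:
  indices up to \<open>n\<close> give at most the former, any larger index at least the latter. For
  \<open>n \<ge> a + K\<close> this gap is long enough to contain a term of the progression.\<close>

lemma sumset_of_lacunary_contains_no_arith_prog:
  fixes s :: "nat \<Rightarrow> nat"
  assumes "mono s" "\<And>n. n \<ge> N \<Longrightarrow> 2 * s n + n < s (Suc n)" "K > 0"
  shows "\<exists>j. \<forall>x y. a + K * j \<noteq> s x + s y"
proof -
  define n where "n = max N (a + K)"
  \<comment> \<open>The least \<open>j\<close> with \<open>K * j\<close> above
    \<open>2 * s n\<close>.\<close>
  define j where "j = Suc (2 * s n div K)"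
  have j: "2 * s n < K * j" "K * j \<le> 2 * s n + K"
    using assms(3) by (simp_all add: j_def dividend_less_times_div)
  have less: "a + K * j < s (Suc n)"
    using j(2) assms(2)[of n] by (simp add: n_def)
  have "a + K * j \<noteq> s x + s y" for x y
  proof (cases "x \<le> n \<and> y \<le> n")
    case True
    then have "s x \<le> s n" "s y \<le> s n" using assms(1) by (auto dest: monoD)
    then show ?thesis using j(1) by linarith
  next
    case False
    then have "s (Suc n) \<le> s x \<or> s (Suc n) \<le> s y"
      using assms(1) by (metis monoD not_less_eq_eq)
    then show ?thesis using less by linarith
  qed
  then show ?thesis by blast
qed

lemma exists_thin_set_with_spread_out_sumset:
  obtains S :: "nat set" where
    "\<And>x. x \<in> S \<Longrightarrow> x mod 4 = 1"
    "\<And>k. \<exists>U\<in>ap_unions. S \<subseteq> U \<and> natural_density U \<le> 1 / 2 ^ k"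
    "\<And>n K. n mod 4 = 2 \<Longrightarrow> K > 0 \<Longrightarrow> \<exists>j. n + K * j \<in> S + S"
    "\<And>n K. n mod 4 = 2 \<Longrightarrow> K > 0 \<Longrightarrow> \<exists>j. n + K * j \<notin> S + S"
proof -
  obtain t where t: "\<And>n. t n \<le> n" "\<And>n. t n \<in> range spread \<union> range (\<lambda>a. 2 * spread a)"
      "\<And>n. t (2 * n) + t (Suc (2 * n)) = n"
    using exists_interleaved_summands by blast
  define s where "s n = t n + fact n" for n
  define S where "S = range (\<lambda>n. 1 + 4 * s n)"
  have "mono s"
  unfolding mono_iff_le_Suc
  proof
    fix n
    \<comment> \<open>The sequence \<open>t\<close> need not be monotone; the increment
      \<open>n * fact n\<close> from \<open>fact n\<close> to \<open>fact (Suc n)\<close> outweighs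
      any drop.\<close>
    have "n \<le> n * fact n" by simp
    then have "t n \<le> n * fact n" using t(1)[of n] by linarith
    then show "s n \<le> s (Suc n)" by (simp add: s_def)
  qed
  \<comment> \<open>Since \<open>fact (Suc n) = 2 * fact n + (n - 1) * fact n\<close> and
    \<open>t n \<le> n\<close>, it is enough that \<open>(n - 1) * fact n > 3 * n\<close>. This
    follows from \<open>fact n \<ge> 6\<close> for \<open>n \<ge> 3\<close>.\<close>
  have lacunary: "2 * s n + n < s (Suc n)" if "n \<ge> 3" for n
  proof -
    obtain p where p: "n = Suc p" using \<open>n \<ge> 3\<close> by (cases n) auto
    have "(6::nat) \<le> fact n"
      using fact_mono_nat[OF that] by (simp add: numeral_3_eq_3)
    then have "p * 6 \<le> p * fact n" by (rule mult_le_mono2)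
    moreover have "fact (Suc n) = 2 * fact n + p * (fact n :: nat)"
      by (metis p fact_Suc of_nat_id add_2_eq_Suc add_mult_distrib)
    moreover define q where "q = p * fact n"
    ultimately have "p * 6 \<le> q" "s (Suc n) = t (Suc n) + 2 * fact n + q"
      unfolding s_def by simp_all
    moreover have "s n = t n + fact n" by (rule s_def)
    ultimately show ?thesis using t(1)[of n] that p by linarith
  qed
  have mem: "z \<in> S + S \<longleftrightarrow> (\<exists>x y. z = 2 + 4 * (s x + s y))" for z
  proof -
    have "1 + 4 * s x + (1 + 4 * s y) = 2 + 4 * (s x + s y)" for x y by simp
    then show ?thesis
      unfolding S_def set_plus_def by (simp only: mem_Collect_eq bex_simps bex_UNIV)
  qed
  show ?thesis
  proof (rule that)
    show "x mod 4 = 1" if "x \<in> S" for x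
    proof -
      obtain n where "x = 1 + 4 * s n" using \<open>x \<in> S\<close> by (auto simp: S_def)
      then show ?thesis by presburger
    qed
    show "\<exists>U\<in>ap_unions. S \<subseteq> U \<and> natural_density U \<le> 1 / 2 ^ k" for k
    proof -
      \<comment> \<open>\<open>U 4\<close> receives the terms with \<open>t n\<close> in the range
        of \<open>spread\<close>, \<open>U 8\<close> those with \<open>t n\<close> twice such a
        value. Each consists of \<open>2 ^ k\<close> progressions modulo
        \<open>4 * 4 ^ k\<close>.\<close>
      define U where "U c = (\<Union>r\<in>{..<2 ^ k :: nat}. arith_prog (1 + c * spread r) (4 * 4 ^ k))" for c
      have U: "U c \<in> ap_unions" for c
        unfolding U_def by (intro UN_arith_prog_in_ap_unions) simp
      have "natural_density (U c) \<le> (1 / 2 ^ k) / 2" for c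
      proof -
        have "natural_density (U c) \<le> (\<Sum>r\<in>{..<2 ^ k :: nat}. 1 / real (4 * 4 ^ k))"
          unfolding U_def by (intro natural_density_UN_arith_prog_le) auto
        also have "\<dots> = (1 / 2 ^ k) / 4"
        proof -
          have "(4::real) ^ k = 2 ^ k * 2 ^ k" by (simp flip: power_mult_distrib)
          then show ?thesis by simp
        qed
        also have "\<dots> \<le> (1 / 2 ^ k) / 2" by (simp add: field_simps)
        finally show ?thesis .
      qed
      \<comment> \<open>From \<open>n = 4 ^ k\<close> on, \<open>4 ^ k\<close> divides
        \<open>fact n\<close>, so that \<open>s n\<close> and \<open>t n\<close> agree modulo
        \<open>4 ^ k\<close>. The earlier terms form a finite set of density 0.\<close>
      moreover define F where "F = (\<lambda>n. 1 + 4 * s n) ` {..<4 ^ k}"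
      have F: "finite F" by (simp add: F_def)
      moreover have "natural_density (F \<union> (U 4 \<union> U 8))
          \<le> natural_density F + (natural_density (U 4) + natural_density (U 8))"
        using natural_density_Un_le[OF finite_in_ap_unions[OF F] ap_unions_Un[OF U U]]
          natural_density_Un_le[OF U U] by (meson add_left_mono order_trans)
      ultimately have "natural_density (F \<union> (U 4 \<union> U 8)) \<le> 1 / 2 ^ k"
        using natural_density_finite[OF F] by (smt (verit) field_sum_of_halves)
      moreover have "S \<subseteq> F \<union> (U 4 \<union> U 8)"
      proof
        fix x assume "x \<in> S"
        then obtain n where x: "x = 1 + 4 * s n" by (auto simp: S_def)
        show "x \<in> F \<union> (U 4 \<union> U 8)"
        proof (cases "n < 4 ^ k")
          case True
          then show ?thesis by (auto simp: F_def x)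
        next
          case False
          then have "(4::nat) ^ k dvd fact n" by (intro dvd_fact) auto
          then obtain p :: nat where p: "fact n = 4 ^ k * p" by (rule dvdE)
          obtain b where "t n = spread b \<or> t n = 2 * spread b" using t(2)[of n] by blast
          moreover obtain r q where r: "r < 2 ^ k" "spread b = spread r + 4 ^ k * q"
            using spread_in_arith_progs by blast
          ultimately have "x = 1 + 4 * spread r + (4 * 4 ^ k) * (q + p)
              \<or> x = 1 + 8 * spread r + (4 * 4 ^ k) * (2 * q + p)"
            unfolding x s_def p by (auto simp: algebra_simps)
          then have "x \<in> arith_prog (1 + 4 * spread r) (4 * 4 ^ k) \<union> arith_prog (1 + 8 * spread r) (4 * 4 ^ k)"
            unfolding arith_prog_def by blast
          then show ?thesis using r(1) by (auto simp: U_def)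
        qed
      qed
      ultimately show ?thesis
        using ap_unions_Un[OF finite_in_ap_unions[OF F] ap_unions_Un[OF U U]] by blast
    qed
    show "\<exists>j. n + K * j \<in> S + S" if "n mod 4 = 2" "K > 0" for n K
    proof -
      obtain m where n: "n = 2 + 4 * m" using \<open>n mod 4 = 2\<close> by (metis mod_mult_div_eq)
      \<comment> \<open>This \<open>i\<close> is congruent to \<open>m\<close> modulo
        \<open>K\<close> and large enough for \<open>K\<close> to divide both factorials, so the
        pair of terms belonging to \<open>i\<close> sums to \<open>m\<close> modulo
        \<open>K\<close>.\<close>
      define i where "i = m + K"
      have "K dvd fact (2 * i)" "K dvd fact (Suc (2 * i))"
        using that(2) by (intro dvd_fact; simp add: i_def)+
      then have "K dvd fact (2 * i) + fact (Suc (2 * i))" by (rule dvd_add)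
      then obtain p where p: "fact (2 * i) + fact (Suc (2 * i)) = K * p" by (rule dvdE)
      have "s (2 * i) + s (Suc (2 * i)) = i + K * p"
        unfolding s_def p[symmetric] using t(3)[of i] by simp
      then have "2 + 4 * (s (2 * i) + s (Suc (2 * i))) = n + K * (4 * (p + 1))"
        by (simp add: n i_def algebra_simps)
      then show ?thesis unfolding mem by metis
    qed
    show "\<exists>j. n + K * j \<notin> S + S" if "n mod 4 = 2" "K > 0" for n K
    proof -
      obtain m where n: "n = 2 + 4 * m" using \<open>n mod 4 = 2\<close> by (metis mod_mult_div_eq)
      obtain j where "\<And>x y. m + K * j \<noteq> s x + s y"
        using sumset_of_lacunary_contains_no_arith_prog[OF \<open>mono s\<close> lacunary \<open>K > 0\<close>] by blast
      \<comment> \<open>A step of \<open>4 * j\<close> stays in the class 2 modulo 4 and corresponds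
        to a step of \<open>j\<close> for the sums of \<open>s\<close>.\<close>
      moreover have "n + K * (4 * j) = 2 + 4 * (m + K * j)" by (simp add: n)
      moreover have "2 + 4 * u = 2 + 4 * v \<longleftrightarrow> u = v" for u v :: nat by simp
      ultimately have "n + K * (4 * j) \<notin> S + S" by (simp only: mem) simp
      then show ?thesis by blast
    qed
  qed
qed

section \<open>Binary expansions and multiples of 4 with prescribed Buck density\<close>

text \<open>The parity of \<open>\<lfloor>2 ^ Suc i * \<beta>\<rfloor>\<close> is the binary digit
  of \<beta> with weight \<open>1 / 2 ^ Suc i\<close>, so the sum is the expansion cut off after
  \<open>k\<close> digits. As \<open>0 \<le> \<beta> < 1\<close>, there is no integer part.\<close>

lemma binary_digits_sum:
  fixes \<beta> :: real
  assumes "0 \<le> \<beta>" "\<beta> < 1"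
  shows "(\<Sum>i\<in>{i. odd \<lfloor>2 ^ Suc i * \<beta>\<rfloor>} \<inter> {..<k}. 1 / 2 ^ Suc i)
    = real_of_int \<lfloor>2 ^ k * \<beta>\<rfloor> / 2 ^ k"
proof (induction k)
  case 0
  then show ?case using assms floor_unique[of 0 \<beta>] by simp
next
  case (Suc k)
  define x where "x = 2 ^ k * \<beta>"
  have "\<lfloor>2 * x\<rfloor> = 2 * \<lfloor>x\<rfloor> \<or> \<lfloor>2 * x\<rfloor> = 2 * \<lfloor>x\<rfloor> + 1" by linarith
  then have step: "real_of_int \<lfloor>2 * x\<rfloor> = 2 * of_int \<lfloor>x\<rfloor> + (if odd \<lfloor>2 * x\<rfloor> then 1 else 0)"
  proof
    assume "\<lfloor>2 * x\<rfloor> = 2 * \<lfloor>x\<rfloor>"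
    then show ?thesis by simp
  next
    assume "\<lfloor>2 * x\<rfloor> = 2 * \<lfloor>x\<rfloor> + 1"
    then show ?thesis by simp
  qed
  have x: "2 ^ Suc k * \<beta> = 2 * x" by (simp add: x_def)
  let ?I = "{i. odd \<lfloor>2 ^ Suc i * \<beta>\<rfloor>}"
  have "?I \<inter> {..<Suc k} = (if odd \<lfloor>2 * x\<rfloor> then insert k (?I \<inter> {..<k}) else ?I \<inter> {..<k})"
    unfolding lessThan_Suc x[symmetric] by auto
  then have "(\<Sum>i\<in>?I \<inter> {..<Suc k}. 1 / 2 ^ Suc i)
      = real_of_int \<lfloor>x\<rfloor> / 2 ^ k + (if odd \<lfloor>2 * x\<rfloor> then 1 / 2 ^ Suc k else 0)"
    using Suc unfolding x_def[symmetric] by simp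
  also have "\<dots> = of_int \<lfloor>2 * x\<rfloor> / 2 ^ Suc k"
    unfolding step by (simp add: field_simps)
  finally show ?case unfolding x .
qed

text \<open>The classes chosen by the first \<open>k\<close> digits of \<open>4 * \<alpha>\<close>
  form an inner approximation \<open>L k\<close>. All later classes lie in the single progression
  \<open>T k\<close> of density \<open>1 / (4 * 2 ^ k)\<close>, so \<open>L k \<union> T k\<close>
  is an outer approximation.\<close>

lemma exists_multiples_of_4_with_density:
  fixes \<alpha> :: real
  assumes "0 \<le> \<alpha>" "\<alpha> < 1 / 4"
  obtains D where "\<And>x. x \<in> D \<Longrightarrow> 4 dvd x"
    "\<And>k. \<exists>L\<in>ap_unions. L \<subseteq> D \<and> \<alpha> - 1 / 2 ^ k \<le> natural_density L"
    "\<And>k. \<exists>U\<in>ap_unions. D \<subseteq> U \<and> natural_density U \<le> \<alpha> + 1 / 2 ^ k"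
proof -
  define I where "I = {i. odd \<lfloor>2 ^ Suc i * (4 * \<alpha>)\<rfloor>}"
  \<comment> \<open>\<open>P i\<close> is four times the set of numbers ending in exactly \<open>i\<close> binary ones,
    \<open>T k\<close> four times the set of those ending in at least \<open>k\<close>.\<close>
  define P where "P i = arith_prog (4 * (2 ^ i - 1)) (4 * 2 ^ Suc i)" for i
  define T where "T k = arith_prog (4 * (2 ^ k - 1)) (4 * 2 ^ k)" for k
  define L where "L k = (\<Union>i\<in>I \<inter> {..<k}. P i)" for k
  have sum: "(\<Sum>i\<in>I \<inter> {..<k}. 1 / real (4 * 2 ^ Suc i)) = of_int \<lfloor>2 ^ k * (4 * \<alpha>)\<rfloor> / 2 ^ k / 4" for k
  proof -
    have "(\<Sum>i\<in>I \<inter> {..<k}. 1 / real (4 * 2 ^ Suc i)) = (\<Sum>i\<in>I \<inter> {..<k}. 1 / 2 ^ Suc i) / 4"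
      unfolding sum_divide_distrib by (intro sum.cong) simp_all
    then show ?thesis
      using binary_digits_sum[of "4 * \<alpha>" k] assms unfolding I_def by simp
  qed
  have P_subset_T: "P i \<subseteq> T k" if "k \<le> i" for i k
  proof
    fix x assume "x \<in> P i"
    then obtain n where n: "x = 4 * (2 ^ i - 1) + 4 * 2 ^ Suc i * n" by (auto simp: P_def arith_prog_def)
    obtain d where d: "i = k + d" using \<open>k \<le> i\<close> by (metis le_iff_add)
    \<comment> \<open>Stated for general positive \<open>u\<close> and \<open>v\<close> in place of
      the powers of 2, since a case analysis on them removes the truncated subtractions.\<close>
    have "4 * (u * v - 1) + 4 * (2 * (u * v)) * n = 4 * (u - 1) + 4 * u * (v - 1 + 2 * v * n)"
      if "u > 0" "v > 0" for u v :: nat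
      using that by (cases u; cases v) (simp_all add: algebra_simps)
    from this[of "2 ^ k" "2 ^ d"]
    have "x = 4 * (2 ^ k - 1) + 4 * 2 ^ k * (2 ^ d - 1 + 2 * 2 ^ d * n)"
      unfolding n d by (simp add: power_add)
    then show "x \<in> T k" unfolding T_def arith_prog_def by blast
  qed
  have P_disjoint_T: "P i \<inter> T (Suc i) = {}" for i
  proof -
    have "4 * (2 ^ i - 1) + 4 * 2 ^ Suc i * m \<noteq> 4 * (2 ^ Suc i - 1) + 4 * 2 ^ Suc i * n" for m n :: nat
    proof
      assume "4 * (2 ^ i - 1) + 4 * 2 ^ Suc i * m = 4 * (2 ^ Suc i - 1) + 4 * 2 ^ Suc i * n"
      \<comment> \<open>With \<open>w = 2 ^ i\<close> a common member would make \<open>w\<close>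
        times an odd number equal to \<open>w\<close> times an even one.\<close>
      moreover have "4 * (w - 1) + 4 * (2 * w) * m = 4 * (2 * w - 1) + 4 * (2 * w) * n
          \<Longrightarrow> w * (1 + 2 * m) = w * (2 * (1 + n))" if "w > 0" for w
        using that by (cases w) (simp_all add: algebra_simps)
      ultimately have "2 ^ i * (1 + 2 * m) = (2::nat) ^ i * (2 * (1 + n))"
        unfolding power_Suc by simp
      then have "1 + 2 * m = 2 * (1 + n)" by (simp only: mult_cancel1) simp
      then show False by presburger
    qed
    then show ?thesis unfolding P_def T_def arith_prog_def by blast
  qed
  have "P i \<inter> P j = {}" if "i < j" for i j
    using P_subset_T[of "Suc i" j] P_disjoint_T[of i] that by fastforce
  then have disj: "disjoint_family_on P J" for J
    unfolding disjoint_family_on_def by (metis inf_commute linorder_neqE_nat)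
  have P_density: "has_density (P i) (1 / real (4 * 2 ^ Suc i))" for i
    unfolding P_def by (rule has_density_arith_prog) simp
  have L_density: "natural_density (L k) = of_int \<lfloor>2 ^ k * (4 * \<alpha>)\<rfloor> / 2 ^ k / 4" for k
    unfolding sum[symmetric] L_def
    by (intro natural_density_eqI has_density_UN disj P_density) simp
  have L: "L k \<in> ap_unions" for k
    unfolding L_def P_def by (intro UN_arith_prog_in_ap_unions) simp
  have T: "T k \<in> ap_unions" for k
    unfolding T_def by (rule arith_prog_in_ap_unions)
  show ?thesis
  proof (rule that[of "\<Union>i\<in>I. P i"])
    show "4 dvd x" if "x \<in> (\<Union>i\<in>I. P i)" for x
      using that by (auto simp: P_def arith_prog_def)
    show "\<exists>L\<in>ap_unions. L \<subseteq> (\<Union>i\<in>I. P i) \<and> \<alpha> - 1 / 2 ^ k \<le> natural_density L" for k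
    proof (intro bexI[of _ "L k"] conjI)
      \<comment> \<open>The generous 4 turns into exactly \<open>1 / 2 ^ k\<close> after division by
        \<open>2 ^ k\<close> and 4.\<close>
      have "2 ^ k * (4 * \<alpha>) - 4 \<le> of_int \<lfloor>2 ^ k * (4 * \<alpha>)\<rfloor>" by linarith
      then have "(2 ^ k * (4 * \<alpha>) - 4) / 2 ^ k / 4 \<le> natural_density (L k)"
        unfolding L_density by (intro divide_right_mono) simp_all
      then show "\<alpha> - 1 / 2 ^ k \<le> natural_density (L k)"
        by (simp add: diff_divide_distrib)
    qed (auto simp: L_def L[unfolded L_def])
    show "\<exists>U\<in>ap_unions. (\<Union>i\<in>I. P i) \<subseteq> U \<and> natural_density U \<le> \<alpha> + 1 / 2 ^ k" for k
    proof (intro bexI[of _ "L k \<union> T k"] conjI)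
      show "(\<Union>i\<in>I. P i) \<subseteq> L k \<union> T k"
      proof (rule UN_least)
        fix i assume "i \<in> I"
        then show "P i \<subseteq> L k \<union> T k"
          using P_subset_T[of k i] by (cases "i < k") (auto simp: L_def)
      qed
      have "natural_density (T k) = 1 / real (4 * 2 ^ k)"
        unfolding T_def by (intro natural_density_eqI has_density_arith_prog) simp
      then have "natural_density (T k) \<le> 1 / 2 ^ k" by (simp add: field_simps)
      moreover have "natural_density (L k) \<le> \<alpha>"
      proof -
        have "natural_density (L k) \<le> 2 ^ k * (4 * \<alpha>) / 2 ^ k / 4"
          unfolding L_density by (intro divide_right_mono of_int_floor_le) simp_all
        then show ?thesis by simp
      qed
      ultimately show "natural_density (L k \<union> T k) \<le> \<alpha> + 1 / 2 ^ k"
        using natural_density_Un_le[OF L T, of k k] by linarith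
    qed (intro ap_unions_Un L T)
  qed
qed

section \<open>The Buck density of A and the gap for A + A\<close>

text \<open>Letting \<open>k\<close> grow squeezes both densities to \<open>d\<close>, as the lower
  never exceeds the upper. The outer error is \<open>2 / 2 ^ k\<close> because a cover of
  \<open>D \<union> S\<close> adds the errors of two covers.\<close>

lemma has_buck_densityI:
  assumes "\<And>k. \<exists>L\<in>ap_unions. L \<subseteq> X \<and> d - 1 / 2 ^ k \<le> natural_density L"
    and "\<And>k. \<exists>U\<in>ap_unions. X \<subseteq> U \<and> natural_density U \<le> d + 2 / 2 ^ k"
  shows "has_buck_density X d"
proof -
  have lim: "(\<lambda>k. c / 2 ^ k) \<longlonglongrightarrow> 0" for c :: real
    using tendsto_mult[OF tendsto_const[of c] LIMSEQ_inverse_realpow_zero[of 2]] by (simp add: divide_inverse)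
  have lower: "d - 1 / 2 ^ k \<le> lower_buck_density X" for k
  proof -
    obtain L where "L \<in> ap_unions" "L \<subseteq> X" "d - 1 / 2 ^ k \<le> natural_density L"
      using assms(1)[of k] by blast
    then show ?thesis using lower_buck_density_ge[of L X] by linarith
  qed
  have upper: "upper_buck_density X \<le> d + 2 / 2 ^ k" for k
  proof -
    obtain U where "U \<in> ap_unions" "X \<subseteq> U" "natural_density U \<le> d + 2 / 2 ^ k"
      using assms(2)[of k] by blast
    then show ?thesis using upper_buck_density_le[of U X] by linarith
  qed
  have "d - 0 \<le> lower_buck_density X"
    by (rule LIMSEQ_le_const2[OF tendsto_diff[OF tendsto_const lim[of 1]]]) (use lower in blast)
  moreover have "upper_buck_density X \<le> d + 0"
    by (rule LIMSEQ_le_const[OF tendsto_add[OF tendsto_const lim[of 2]]]) (use upper in blast)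
  ultimately show ?thesis
    using lower_le_upper_buck_density[of X] by (simp add: has_buck_density_def)
qed

theorem theorem1p3:
  fixes \<alpha> :: real
  assumes "0 \<le> \<alpha>" and "\<alpha> < 1 / 4"
  shows "\<exists>A :: nat set. has_buck_density A \<alpha> \<and>
    lower_buck_density (A + A) \<noteq> upper_buck_density (A + A)"
proof -
  obtain D where D: "\<And>x. x \<in> D \<Longrightarrow> 4 dvd x"
    and D_inner: "\<And>k. \<exists>L\<in>ap_unions. L \<subseteq> D \<and> \<alpha> - 1 / 2 ^ k \<le> natural_density L"
    and D_outer: "\<And>k. \<exists>U\<in>ap_unions. D \<subseteq> U \<and> natural_density U \<le> \<alpha> + 1 / 2 ^ k"
    using exists_multiples_of_4_with_density[OF assms] by metis
  obtain S where S: "\<And>x. x \<in> S \<Longrightarrow> x mod 4 = 1"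
    and S_outer: "\<And>k. \<exists>U\<in>ap_unions. S \<subseteq> U \<and> natural_density U \<le> 1 / 2 ^ k"
    and meets: "\<And>n K. n mod 4 = 2 \<Longrightarrow> K > 0 \<Longrightarrow> \<exists>j. n + K * j \<in> S + S"
    and misses: "\<And>n K. n mod 4 = 2 \<Longrightarrow> K > 0 \<Longrightarrow> \<exists>j. n + K * j \<notin> S + S"
    using exists_thin_set_with_spread_out_sumset by metis
  define A where "A = D \<union> S"
  have "has_buck_density A \<alpha>"
  proof (rule has_buck_densityI)
    show "\<exists>L\<in>ap_unions. L \<subseteq> A \<and> \<alpha> - 1 / 2 ^ k \<le> natural_density L" for k
      using D_inner[of k] by (auto simp: A_def)
    show "\<exists>U\<in>ap_unions. A \<subseteq> U \<and> natural_density U \<le> \<alpha> + 2 / 2 ^ k" for k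
    proof -
      obtain U V where U: "U \<in> ap_unions" "D \<subseteq> U" "natural_density U \<le> \<alpha> + 1 / 2 ^ k"
        and V: "V \<in> ap_unions" "S \<subseteq> V" "natural_density V \<le> 1 / 2 ^ k"
        using D_outer[of k] S_outer[of k] by blast
      have "natural_density (U \<union> V) \<le> \<alpha> + 2 / 2 ^ k"
        using natural_density_Un_le[OF U(1) V(1)] U(3) V(3) by simp
      then show ?thesis using U V ap_unions_Un[OF U(1) V(1)] unfolding A_def by blast
    qed
  qed
  \<comment> \<open>Members of \<open>A\<close> are 0 or 1 modulo 4, and those that are 1 lie in
    \<open>S\<close>; a sum can be 2 modulo 4 only as 1 + 1.\<close>
  have sumset: "x \<in> S + S" if "x \<in> A + A" "x mod 4 = 2" for x
  proof -
    obtain a b where ab: "x = a + b" "a \<in> A" "b \<in> A" using \<open>x \<in> A + A\<close> by (rule set_plus_elim)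
    have cases: "y mod 4 = 0 \<or> y mod 4 = 1 \<and> y \<in> S" if "y \<in> A" for y
      using that D S by (auto simp: A_def)
    then have "a mod 4 = 0 \<or> a mod 4 = 1" "b mod 4 = 0 \<or> b mod 4 = 1" using ab by blast+
    moreover have "(a mod 4 + b mod 4) mod 4 = 2" using that(2) ab(1) by (simp add: mod_add_eq)
    ultimately have "a mod 4 = 1" "b mod 4 = 1" by auto
    then have "a \<in> S" "b \<in> S" using cases[OF ab(2)] cases[OF ab(3)] by simp_all
    then show ?thesis using ab(1) by (simp add: set_plus_intro)
  qed
  have "lower_buck_density (A + A) + 1 / 4 \<le> upper_buck_density (A + A)"
  proof (rule buck_density_gapI)
    fix B C assume BC: "B \<in> ap_unions" "C \<in> ap_unions" "B \<subseteq> A + A" "A + A \<subseteq> C"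
    obtain K N where K: "K > 0" "\<And>n j. n \<ge> N \<Longrightarrow> n + K * j \<in> B \<longleftrightarrow> n \<in> B"
      using ap_unions_eventually_periodic[OF BC(1)] by metis
    obtain K' N' where K': "K' > 0" "\<And>n j. n \<ge> N' \<Longrightarrow> n + K' * j \<in> C \<longleftrightarrow> n \<in> C"
      using ap_unions_eventually_periodic[OF BC(2)] by metis
    let ?Q = "arith_prog 2 4"
    have Q: "n mod 4 = 2" if "n \<in> ?Q" for n using that unfolding arith_prog_def by (auto simp del: add_2_eq_Suc)
    \<comment> \<open>A member of \<open>B\<close> in this class beyond \<open>N\<close> would bring
      a whole progression of step \<open>4 * K\<close> into \<open>B\<close>. That step preserves
      the class, so the progression would lie in \<open>S + S\<close>, contrary to
      \<open>misses\<close>.\<close>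
    have "n < N" if "n \<in> B \<inter> ?Q" for n
    proof (rule ccontr)
      assume "\<not> n < N"
      then have "n + (4 * K) * j \<in> B" for j using K(2)[of n "4 * j"] that by (simp add: mult_ac)
      then have "n + (4 * K) * j \<in> A + A" for j using BC(3) by blast
      moreover have "(n + (4 * K) * j) mod 4 = 2" for j
        using Q that by (simp add: mult.assoc)
      ultimately have "\<And>j. n + (4 * K) * j \<in> S + S" using sumset by blast
      then show False using misses[of n "4 * K"] Q that K(1) by auto
    qed
    \<comment> \<open>The class 2 modulo 4 with an initial part removed: it avoids \<open>B\<close>
      and still has density 1/4.\<close>
    moreover define Q where "Q = arith_prog (2 + 4 * N) 4"
    moreover have "n \<ge> N" "n \<in> ?Q" if nQ: "n \<in> Q" for n
    proof -
      obtain i where "n = 2 + 4 * N + 4 * i"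
        using nQ unfolding Q_def arith_prog_def by blast
      then have "n = 2 + 4 * (N + i)" by simp
      then show "n \<ge> N" "n \<in> ?Q" unfolding arith_prog_def by (simp, blast)
    qed
    ultimately have disj: "B \<inter> Q = {}" and sub: "Q \<subseteq> ?Q" by fastforce+
    \<comment> \<open>Some \<open>n + K' * j\<close> lies in \<open>S + S\<close> and hence in
      \<open>C\<close>; periodicity of \<open>C\<close>, read backwards, puts \<open>n\<close>
      itself into \<open>C\<close>. So \<open>C\<close> contains all but finitely many numbers of
      the class.\<close>
    have "n < N'" if "n \<in> ?Q - C" for n
    proof (rule ccontr)
      assume "\<not> n < N'"
      obtain j where "n + K' * j \<in> S + S" using meets[OF Q K'(1), of n] \<open>n \<in> ?Q - C\<close> by blast
      moreover have "S + S \<subseteq> A + A" by (intro set_plus_mono2) (auto simp: A_def)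
      ultimately have "n \<in> C" using K'(2)[of n j] \<open>\<not> n < N'\<close> BC(4) by auto
      then show False using that by simp
    qed
    then have "finite (?Q - C)" by (meson finite_nat_set_iff_bounded)
    then have fin: "finite (B \<union> Q - C)"
      by (rule finite_subset[rotated]) (use BC(3,4) sub in blast)
    \<comment> \<open>The disjoint sets \<open>B\<close> and \<open>Q\<close> both lie in
      \<open>C\<close> up to finitely many points, so their densities add up to at most that of
      \<open>C\<close>.\<close>
    have "has_density (B \<union> Q) (natural_density B + 1 / 4)"
      using has_density_Un[OF ap_unions_has_density[OF BC(1)] has_density_arith_prog[of 4 "2 + 4 * N"]] disj
      by (simp add: Q_def)
    from has_density_almost_mono[OF this ap_unions_has_density[OF BC(2)] fin]
    show "natural_density B + 1 / 4 \<le> natural_density C" .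
  qed
  then have "lower_buck_density (A + A) \<noteq> upper_buck_density (A + A)" by simp
  then show ?thesis using \<open>has_buck_density A \<alpha>\<close> by blast
qed

end
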